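(* Let $f(X)\in\mathbb{F}_q[X]$ be a nonconstant monic squarefree polynomial coprime to $X$, and let $m=\mathrm{ord}(f)$. Then $f(X)$ is a binomial if and only if its primitive defining set $T_f\subseteq\mathbb{Z}/m\mathbb{Z}$ is an equal-difference subset of $\mathbb{Z}/m\mathbb{Z}$.
   Context: $q$ is a prime power. A binomial is a polynomial $X^{n}-\lambda$ with $n\geq1$, $\lambda\in\mathbb{F}_q^{\ast}$. The order $\mathrm{ord}(g)$ of a polynomial $g$ coprime to $X$ is the least positive $m$ with $g\mid X^m-1$. Fix a compatible family $\{\zeta_n:\gcd(n,q)=1\}$ of primitive $n$-th roots of unity in an algebraic closure of $\mathbb{F}_q$ ($\zeta_n^{n/m}=\zeta_m$ for $m\mid n$). For squarefree $g$ coprime to $X$ of order $m$, the primitive defining set $T_g\subseteq\mathbb{Z}/m\mathbb{Z}$ is defined by $g=a\prod_{\gamma\in T_g}(X-\zeta_m^{\gamma})$, $a\in\mathbb{F}_q^\ast$. An equal-difference subset of $\mathbb{Z}/m\mathbb{Z}$ is one of the form $\{\gamma,\gamma+d,\dots,\gamma+(\tfrac md-1)d\}$ with $d$ a positive divisor of $m$. *)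

theory Defs
  imports
    "HOL-Library.Cardinality"
    "HOL-Computational_Algebra.Computational_Algebra"
    "HOL-Algebra.Algebraic_Closure_Type"
begin

definition binomial_poly :: "'a :: field poly \<Rightarrow> bool" where
  "binomial_poly f \<longleftrightarrow> (\<exists>n c. n \<ge> 1 \<and> c \<noteq> 0 \<and> f = monom 1 n - [:c:])"

(* Over a finite field, such an m exists exactly when g is coprime to X. *)
definition poly_ord :: "'a :: field poly \<Rightarrow> nat" where
  "poly_ord g = (LEAST m. m > 0 \<and> g dvd monom 1 m - 1)"

definition primitive_root_of_unity :: "nat \<Rightarrow> 'b :: field \<Rightarrow> bool" where
  "primitive_root_of_unity n z \<longleftrightarrow>
     n > 0 \<and> z ^ n = 1 \<and> (\<forall>k. 0 < k \<and> k < n \<longrightarrow> z ^ k \<noteq> 1)"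

(* Here q = CARD('a). The values of \<zeta> at indices not coprime to q are unconstrained. *)
definition compatible_roots_of_unity :: "(nat \<Rightarrow> 'a :: finite_field alg_closure) \<Rightarrow> bool" where
  "compatible_roots_of_unity \<zeta> \<longleftrightarrow>
     (\<forall>n. coprime n CARD('a) \<longrightarrow> primitive_root_of_unity n (\<zeta> n)) \<and>
     (\<forall>m n. coprime n CARD('a) \<and> m dvd n \<longrightarrow> \<zeta> n ^ (n div m) = \<zeta> m)"

(* A subset of Z/mZ is represented by its set of residues in {..<m}.
   The set below exists and is unique if g is squarefree and coprime to X
   and \<zeta> is a compatible family. *)
definition primitive_defining_set ::
    "(nat \<Rightarrow> 'a :: finite_field alg_closure) \<Rightarrow> 'a poly \<Rightarrow> nat set" where
  "primitive_defining_set \<zeta> g =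
     (THE T. T \<subseteq> {..<poly_ord g} \<and>
        (\<exists>a. a \<noteq> 0 \<and>
           map_poly to_ac g = smult (to_ac a) (\<Prod>\<gamma>\<in>T. [:- (\<zeta> (poly_ord g) ^ \<gamma>), 1:])))"

definition equal_difference_subset :: "nat \<Rightarrow> nat set \<Rightarrow> bool" where
  "equal_difference_subset m T \<longleftrightarrow>
     (\<exists>\<gamma> d. \<gamma> < m \<and> d > 0 \<and> d dvd m \<and> T = (\<lambda>i. (\<gamma> + i * d) mod m) ` {..<m div d})"

end

theory Submission
  imports Defs "HOL-Algebra.Sylow"
begin

text \<open>
  A squarefree \<open>f\<close> dividing \<open>(X\<^sup>k - 1)\<^sup>p\<close> divides \<open>X\<^sup>k - 1\<close>, so \<open>m\<close> is coprime to the
  characteristic, \<open>X\<^sup>m - 1\<close> has \<open>m\<close> distinct roots, and \<open>f\<close> is determined by its set of roots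
  \<open>\<zeta>\<^sub>m\<^sup>\<gamma>\<close>, \<open>\<gamma> \<in> T\<^sub>f\<close>.  The roots of \<open>X\<^sup>n - b\<close> form a coset of the group of \<open>n\<close>-th roots of
  unity, and the exponents of such a coset are exactly an equal-difference set with \<open>d = m/n\<close>.
\<close>

subsection \<open>Finite fields\<close>

text \<open>Sylow's theorem for the additive group gives a subgroup of order \<open>r\<close>. A
  nonzero \<open>x\<close> in it satisfies \<open>of_nat r * x = 0\<close>, so the characteristic
  divides the prime \<open>r\<close>. This turns a common factor with \<open>CARD('a)\<close> into
  the exponent needed for the Frobenius identity.\<close>

lemma prime_dvd_CARD_imp_CHAR:
  assumes "prime r" "r dvd CARD('a :: finite_field)"
  shows "r = CHAR('a)"
proof -
  define G where "G = \<lparr>carrier = (UNIV :: 'a set), monoid.mult = (+), one = (0 :: 'a)\<rparr>"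
  have G: "group G"
  proof (rule groupI)
    fix x assume "x \<in> carrier G"
    show "\<exists>y\<in>carrier G. y \<otimes>\<^bsub>G\<^esub> x = \<one>\<^bsub>G\<^esub>"
      by (intro bexI[of _ "-x"]) (auto simp: G_def)
  qed (auto simp: G_def add_ac)
  obtain s where "CARD('a) = r * s"
    using assms(2) by (elim dvdE)
  \<comment> \<open>The cofactor \<open>s\<close> may still be divisible by \<open>r\<close>; with
    exponent 1, Sylow's theorem yields a subgroup of order exactly \<open>r\<close>.\<close>
  then have "Coset.order G = r ^ 1 * s"
    by (simp add: Coset.order_def G_def)
  from sylow_thm[OF assms(1) G this] obtain H where H: "subgroup H G" "card H = r"
    by (auto simp: G_def)
  have "finite H"
    by simp
  then have "H \<noteq> {0}"
    using H(2) assms(1) by auto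
  moreover have "0 \<in> H"
    using subgroup.one_closed[OF H(1)] by (simp add: G_def)
  ultimately obtain x where x: "x \<in> H" "x \<noteq> 0"
    by auto
  interpret HG: group "G\<lparr>carrier := H\<rparr>"
    using H(1) G by (rule subgroup.subgroup_is_group)
  have pow: "y [^]\<^bsub>G\<lparr>carrier := H\<rparr>\<^esub> (n :: nat) = of_nat n * y" for y n
    by (induction n) (auto simp: nat_pow_def G_def algebra_simps)
  have "x [^]\<^bsub>G\<lparr>carrier := H\<rparr>\<^esub> r = \<one>\<^bsub>G\<lparr>carrier := H\<rparr>\<^esub>"
    using HG.pow_order_eq_1[of x] x(1) H(2) by (simp add: Coset.order_def)
  then have "of_nat r = (0 :: 'a)"
    using x(2) unfolding pow by (simp add: G_def)
  then have "CHAR('a) dvd r"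
    by (simp add: of_nat_eq_0_iff_char_dvd)
  with assms(1) show ?thesis
    by (metis CHAR_not_1 One_nat_def prime_nat_iff)
qed

subsection \<open>The order of a polynomial\<close>

lemma field_poly_irreducible_divisor_exists:
  fixes f :: "'a :: field poly"
  assumes "f \<noteq> 0" "\<not> is_unit f"
  shows "\<exists>p. irreducible p \<and> p dvd f"
  using assms
proof (induction "degree f" arbitrary: f rule: less_induct)
  case less
  show ?case
  proof (cases "irreducible f")
    case False
    then obtain a b where ab: "f = a * b" "\<not> is_unit a" "\<not> is_unit b"
      using less.prems by (auto simp: irreducible_def)
    then have nz: "a \<noteq> 0" "b \<noteq> 0"
      using less.prems(1) by auto
    then have "degree b > 0"
      using ab(3) by (simp add: is_unit_iff_degree)
    then have "degree a < degree f"
      using nz by (simp add: ab(1) degree_mult_eq)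
    then obtain p where "irreducible p" "p dvd a"
      using less.hyps nz(1) ab(2) by blast
    then show ?thesis
      by (auto simp: ab(1))
  qed auto
qed

text \<open>Split off a prime factor, f = p f'. By induction g = f' e. Since f is squarefree, p does
  not divide f', so from p | g it follows that p | e, hence p f' | g.\<close>

lemma squarefree_dvd_power_imp_dvd:
  fixes f g :: "'a :: field poly"
  assumes "squarefree f" "f dvd g ^ k"
  shows "f dvd g"
  using assms
proof (induction "degree f" arbitrary: f rule: less_induct)
  case less
  have "f \<noteq> 0"
    using less.prems(1) by auto
  show ?case
  proof (cases "is_unit f")
    case True
    then show ?thesis
      by (rule unit_imp_dvd)
  next
    case False
    with \<open>f \<noteq> 0\<close> obtain p where p: "p dvd f" "prime_elem p"
      using field_poly_irreducible_divisor_exists field_poly_irreducible_imp_prime by blast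
    then obtain f' where f': "f = p * f'"
      by (elim dvdE)
    have "p dvd g"
      using p less.prems(2) by (metis dvd_trans prime_elem_dvd_power)
    have not: "\<not> p dvd f'"
    proof
      assume "p dvd f'"
      then have "p ^ 2 dvd f"
        by (simp add: f' power2_eq_square mult_dvd_mono)
      with less.prems(1) p(2) show False
        by (meson prime_elem_not_unit squarefreeD)
    qed
    have "degree p > 0"
      using p(2) by (metis is_unit_iff_degree neq0_conv prime_elem_def)
    then have "degree f' < degree f"
      using \<open>f \<noteq> 0\<close> unfolding f' by (subst degree_mult_eq) auto
    moreover have "squarefree f'" "f' dvd g ^ k"
      using less.prems by (auto simp: f' dest: squarefree_multD dvd_mult_right)
    ultimately have "f' dvd g"
      using less.hyps by blast
    then obtain e where e: "g = f' * e"
      by (elim dvdE)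
    with \<open>p dvd g\<close> not p(2) have "p dvd e"
      by (simp add: prime_elem_dvd_mult_iff)
    then show ?thesis
      by (simp add: e f' mult.commute[of p] mult_dvd_mono)
  qed
qed

text \<open>One factor X is stripped at a time: if X h = f k, then the constant coefficient of f k
  vanishes while that of f does not, so X divides k and can be cancelled on both sides.\<close>

lemma dvd_monom_mult_cancel:
  fixes f h :: "'a :: field poly"
  assumes "coeff f 0 \<noteq> 0" "f dvd monom 1 i * h"
  shows "f dvd h"
  using assms(2)
proof (induction i)
  case (Suc i)
  then obtain k where k: "monom 1 (Suc i) * h = f * k"
    by (elim dvdE)
  have X: "monom 1 (Suc i) * h = pCons 0 (monom 1 i * h)"
    by (simp add: monom_Suc)
  have "coeff f 0 * coeff k 0 = 0"
    using arg_cong[OF k, of "\<lambda>p. coeff p 0"] unfolding X by (simp add: coeff_mult)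
  with assms(1) have "coeff k 0 = 0"
    by simp
  then obtain k' where k': "k = pCons 0 k'"
    by (metis coeff_pCons_0 pCons_cases)
  have "monom 1 i * h = f * k'"
    using k unfolding X k' by simp
  then show ?case
    using Suc.IH by simp
qed (simp add: monom_0)

lemma coprime_X_imp_coeff_0_nonzero:
  fixes f :: "'a :: field poly"
  assumes "coprime f [:0, 1:]"
  shows "coeff f 0 \<noteq> 0"
proof
  assume "coeff f 0 = 0"
  then have "[:0, 1:] dvd f"
    using poly_eq_0_iff_dvd[of f 0] by (simp add: poly_0_coeff_0)
  with assms have "is_unit [:0, 1 :: 'a:]"
    by (meson coprime_common_divisor dvd_refl)
  then show False
    by (simp add: is_unit_iff_degree)
qed

text \<open>Pigeonhole: there are only finitely many remainders modulo f, so two powers X^i and X^j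
  with i < j agree modulo f, and the common factor X^i can be cancelled.\<close>

lemma poly_ord_exists:
  fixes f :: "'a :: finite_field poly"
  assumes "coeff f 0 \<noteq> 0"
  shows "\<exists>m>0. f dvd monom 1 m - 1"
proof -
  have fin: "finite {p :: 'a poly. degree p \<le> degree f}"
  proof (rule finite_surj)
    show "finite {xs :: 'a list. set xs \<subseteq> UNIV \<and> length xs \<le> Suc (degree f)}"
      by (rule finite_lists_length_le) simp
    show "{p :: 'a poly. degree p \<le> degree f} \<subseteq>
            Poly ` {xs. set xs \<subseteq> UNIV \<and> length xs \<le> Suc (degree f)}"
    proof
      fix p :: "'a poly" assume "p \<in> {p. degree p \<le> degree f}"
      then show "p \<in> Poly ` {xs. set xs \<subseteq> UNIV \<and> length xs \<le> Suc (degree f)}"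
        by (intro image_eqI[of _ _ "coeffs p"]; cases "p = 0") (auto simp: length_coeffs_degree)
    qed
  qed
  have f0: "f \<noteq> 0"
    using assms by auto
  \<comment> \<open>The bound is not strict because of a constant f, for which the remainder is 0
    and both degrees are 0.\<close>
  have "range (\<lambda>i. monom 1 i mod f) \<subseteq> {p. degree p \<le> degree f}"
    using degree_mod_less[OF f0] by (metis (no_types, lifting) degree_0 image_subsetI le0 less_imp_le mem_Collect_eq)
  with fin have "\<not> inj (\<lambda>i. monom 1 i mod f)"
    using finite_subset range_inj_infinite by blast
  then obtain a b where "a \<noteq> b" "monom 1 a mod f = monom 1 b mod f"
    by (auto simp: inj_def)
  then obtain i j where ij: "i < j" "monom 1 j mod f = monom 1 i mod f"
    by (metis linorder_neqE_nat)
  then have "f dvd monom 1 j - monom 1 i"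
    by (simp add: mod_eq_dvd_iff)
  also have "monom 1 j - monom 1 i = monom 1 i * (monom 1 (j - i) - 1 :: 'a poly)"
    using ij(1) by (simp add: algebra_simps mult_monom)
  finally have "f dvd monom 1 (j - i) - 1"
    using assms dvd_monom_mult_cancel by blast
  with ij(1) show ?thesis
    by (intro exI[of _ "j - i"]) auto
qed

lemma poly_ord:
  fixes f :: "'a :: finite_field poly"
  assumes "coeff f 0 \<noteq> 0"
  shows poly_ord_pos: "poly_ord f > 0"
    and dvd_monom_poly_ord: "f dvd monom 1 (poly_ord f) - 1"
  using LeastI_ex[OF poly_ord_exists[OF assms]] unfolding poly_ord_def by auto

lemma poly_ord_le: "m > 0 \<Longrightarrow> f dvd monom 1 m - 1 \<Longrightarrow> poly_ord f \<le> m"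
  unfolding poly_ord_def by (rule Least_le) simp

text \<open>If the characteristic r divided the order k r, then f would divide X^(kr) - 1 = (X^k -
  1)^r. Being squarefree, it would already divide X^k - 1, against the minimality of the order.
  Coprimality is what makes \<open>\<zeta> (poly_ord f)\<close> a primitive root of unity.\<close>

lemma coprime_poly_ord:
  fixes f :: "'a :: finite_field poly"
  assumes "squarefree f" "coeff f 0 \<noteq> 0"
  shows "coprime (poly_ord f) CARD('a)"
proof (rule ccontr)
  assume "\<not> ?thesis"
  then have "gcd (poly_ord f) CARD('a) \<noteq> 1"
    by (simp add: coprime_iff_gcd_eq_1)
  then obtain r where r: "prime r" "r dvd gcd (poly_ord f) CARD('a)"
    using prime_factor_nat by blast
  then have r_eq: "r = CHAR('a)"
    by (intro prime_dvd_CARD_imp_CHAR) auto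
  from r(2) obtain k where k: "poly_ord f = k * r"
    by (metis dvdE gcd_nat.bounded_iff mult.commute)
  have "k > 0"
    using poly_ord_pos[OF assms(2)] k by (cases k) auto
  \<comment> \<open>Expanding the sum (X^k - 1) + 1 instead of a difference avoids the sign (-1)^r,
    so r = 2 needs no separate case.\<close>
  have "((monom 1 k - 1 :: 'a poly) + 1) ^ r = (monom 1 k - 1) ^ r + 1 ^ r"
    by (rule freshmans_dream) (use r r_eq in auto)
  then have "(monom 1 k - 1 :: 'a poly) ^ r = monom 1 (poly_ord f) - 1"
    by (simp add: monom_power k)
  then have "f dvd monom 1 k - 1"
    using dvd_monom_poly_ord[OF assms(2)] assms(1) squarefree_dvd_power_imp_dvd by metis
  with \<open>k > 0\<close> have "poly_ord f \<le> k"
    by (rule poly_ord_le)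
  with \<open>k > 0\<close> prime_gt_1_nat[OF r(1)] k show False
    by simp
qed

subsection \<open>Roots\<close>

text \<open>Both sides are monic of degree \<open>card S\<close> and vanish on \<open>S\<close>.
  Their difference has smaller degree or is 0, so that many zeros force it to be 0.\<close>

lemma monic_eq_prod_roots:
  fixes p :: "'a :: idom poly"
  assumes "lead_coeff p = 1" "finite S" "card S = degree p" "\<And>x. x \<in> S \<Longrightarrow> poly p x = 0"
  shows "p = (\<Prod>x\<in>S. [:- x, 1:])"
proof (rule poly_eqI_degree_lead_coeff)
  have deg: "degree (\<Prod>x\<in>S. [:- x, 1:]) = degree p"
    by (subst degree_prod_sum_eq) (auto simp: assms)
  have "lead_coeff (\<Prod>x\<in>S. [:- x, 1:]) = 1"
    by (simp add: lead_coeff_prod)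
  then show "coeff p (degree p) = coeff (\<Prod>x\<in>S. [:- x, 1:]) (degree p)"
    using assms(1) deg by simp
  show "degree (\<Prod>x\<in>S. [:- x, 1:]) \<le> degree p"
    by (simp add: deg)
  show "poly p x = poly (\<Prod>x\<in>S. [:- x, 1:]) x" if "x \<in> S" for x
    using that assms by (auto simp: poly_prod)
qed (use assms in auto)

lemma degree_monom_minus_const:
  fixes c :: "'a :: idom"
  assumes "n > 0"
  shows "degree (monom 1 n - [:c:]) = n" "lead_coeff (monom 1 n - [:c:]) = 1"
proof -
  have "degree (monom 1 n - [:c:]) \<le> n"
    by (rule degree_diff_le) (simp_all add: degree_monom_le)
  moreover have "coeff (monom 1 n - [:c:]) n = 1"
    using assms by (cases n) auto
  then have "n \<le> degree (monom 1 n - [:c:])"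
    by (intro le_degree) simp
  ultimately show deg: "degree (monom 1 n - [:c:]) = n"
    by (rule antisym)
  show "lead_coeff (monom 1 n - [:c:]) = 1"
    unfolding deg using assms by (cases n) auto
qed

lemma card_roots_of_unity_le:
  fixes c :: "'a :: idom"
  assumes "n > 0"
  shows "finite {x :: 'a. x ^ n = c}" "card {x :: 'a. x ^ n = c} \<le> n"
proof -
  define p where "p = monom 1 n - [:c:]"
  have "degree p = n" "p \<noteq> 0"
    using degree_monom_minus_const[OF assms, of c] assms by (auto simp: p_def)
  moreover have "{x. x ^ n = c} = {x. poly p x = 0}"
    by (simp add: p_def poly_monom)
  ultimately show "finite {x :: 'a. x ^ n = c}" "card {x :: 'a. x ^ n = c} \<le> n"
    using poly_roots_finite[of p] card_poly_roots_bound[of p] by auto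
qed

text \<open>A counting substitute for separability: write X^m - 1 = p q. The m distinct roots are
  shared between p and q, and neither has more roots than its degree, so both bounds are
  attained.\<close>

lemma card_roots_eq_degree:
  fixes p :: "'a :: field poly"
  assumes "p dvd monom 1 m - 1" "m > 0" "card {x :: 'a. x ^ m = 1} = m"
  shows "card {x. poly p x = 0} = degree p"
proof -
  obtain q where q: "monom 1 m - 1 = p * q"
    using assms(1) by (elim dvdE)
  have deg: "degree (monom 1 m - 1 :: 'a poly) = m"
    using degree_monom_minus_const(1)[OF assms(2), of 1] by (simp add: one_pCons)
  then have nz: "p \<noteq> 0" "q \<noteq> 0"
    using q assms(2) by auto
  then have "degree p + degree q = m"
    using deg by (simp add: q degree_mult_eq)
  moreover have "{x. x ^ m = 1} = {x. poly p x = 0} \<union> {x. poly q x = 0}"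
  proof -
    have "x ^ m - 1 = poly p x * poly q x" for x
      using arg_cong[OF q, of "\<lambda>r. poly r x"] by (simp add: poly_monom)
    then have "x ^ m = 1 \<longleftrightarrow> poly p x = 0 \<or> poly q x = 0" for x
      by (metis eq_iff_diff_eq_0 mult_eq_0_iff)
    then show ?thesis
      by auto
  qed
  then have "m \<le> card {x. poly p x = 0} + card {x. poly q x = 0}"
    using assms(3) card_Un_le[of "{x. poly p x = 0}" "{x. poly q x = 0}"] by simp
  ultimately show ?thesis
    using card_poly_roots_bound[OF nz(1)] card_poly_roots_bound[OF nz(2)] by linarith
qed

lemma primitive_root_inj_on:
  assumes "primitive_root_of_unity m z"
  shows "inj_on (\<lambda>i. z ^ i) {..<m}"
proof (rule linorder_inj_onI')
  fix i j assume ij: "i \<in> {..<m}" "j \<in> {..<m}" "i < j"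
  have "z \<noteq> 0"
    using assms by (auto simp: primitive_root_of_unity_def power_0_left split: if_splits)
  have "z ^ j = z ^ i * z ^ (j - i)"
    using ij by (simp flip: power_add)
  moreover have "z ^ (j - i) \<noteq> 1"
    using ij assms by (auto simp: primitive_root_of_unity_def)
  ultimately show "z ^ i \<noteq> z ^ j"
    using \<open>z \<noteq> 0\<close> by auto
qed

text \<open>The m powers of \<open>z\<close> are distinct roots of X^m - 1, which has at most m of
  them.\<close>

lemma roots_of_unity_eq_powers:
  fixes z :: "'a :: field"
  assumes "primitive_root_of_unity m z"
  shows "{x. x ^ m = 1} = (\<lambda>i. z ^ i) ` {..<m}" "card {x :: 'a. x ^ m = 1} = m"
proof -
  have m: "m > 0" and z: "z ^ m = 1"
    using assms by (auto simp: primitive_root_of_unity_def)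
  have card: "card ((\<lambda>i. z ^ i) ` {..<m}) = m"
    by (simp add: card_image primitive_root_inj_on[OF assms])
  have "(z ^ i) ^ m = 1" for i
    using z by (metis mult.commute power_mult power_one)
  then have "(\<lambda>i. z ^ i) ` {..<m} \<subseteq> {x. x ^ m = 1}"
    by auto
  then show eq: "{x. x ^ m = 1} = (\<lambda>i. z ^ i) ` {..<m}"
    using card_subset_eq card_mono card_roots_of_unity_le[OF m] card by (metis order_antisym)
  show "card {x :: 'a. x ^ m = 1} = m"
    unfolding eq by (rule card)
qed

text \<open>Lets the reduction \<open>mod m\<close> in the encoding of residue classes be dropped in
  exponents.\<close>

lemma primitive_root_power_mod:
  assumes "primitive_root_of_unity m z"
  shows "z ^ (k mod m) = z ^ k"
proof -
  have "z ^ k = z ^ (m * (k div m) + k mod m)"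
    by simp
  also have "\<dots> = z ^ (k mod m)"
    using assms by (simp only: power_add power_mult primitive_root_of_unity_def) simp
  finally show ?thesis ..
qed

subsection \<open>The primitive defining set\<close>

lemma map_poly_to_ac_mult:
  "map_poly to_ac (p * q) = map_poly to_ac p * map_poly to_ac (q :: 'a :: field poly)"
  by (rule poly_eqI) (simp add: coeff_map_poly coeff_mult to_ac_sum)

text \<open>Replaces the definite description by an explicit set of exponents. Existence: F divides
  X^m - 1, so it splits into distinct linear factors at powers of \<open>\<zeta> m\<close>.
  Uniqueness: exponents below m are determined by these powers.\<close>

lemma primitive_defining_set_eq:
  fixes f :: "'a :: finite_field poly"
  assumes "compatible_roots_of_unity \<zeta>" "lead_coeff f = 1" "squarefree f" "coeff f 0 \<noteq> 0"
  defines "m \<equiv> poly_ord f" and "F \<equiv> map_poly to_ac f"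
  defines "T \<equiv> primitive_defining_set \<zeta> f"
  shows "T = {i. i < m \<and> poly F (\<zeta> m ^ i) = 0}"
    and "F = (\<Prod>\<gamma>\<in>T. [:- (\<zeta> m ^ \<gamma>), 1:])"
    and "{x. poly F x = 0} = (\<lambda>i. \<zeta> m ^ i) ` T"
    and "card T = degree F"
    and "primitive_root_of_unity m (\<zeta> m)"
proof -
  have m: "m > 0" and dvd: "f dvd monom 1 m - 1"
    using poly_ord[OF assms(4)] by (auto simp: m_def)
  show prim: "primitive_root_of_unity m (\<zeta> m)"
    using assms(1) coprime_poly_ord[OF assms(3,4)]
    by (auto simp: compatible_roots_of_unity_def m_def)
  define R where "R = {x. poly F x = 0}"
  define T' where "T' = {i. i < m \<and> poly F (\<zeta> m ^ i) = 0}"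
  have "F dvd map_poly to_ac (monom 1 m - 1)"
    using dvd by (auto simp: F_def map_poly_to_ac_mult elim!: dvdE)
  also have "map_poly to_ac (monom 1 m - 1 :: 'a poly) = monom 1 m - 1"
    by (rule poly_eqI) (simp add: coeff_map_poly)
  finally have F_dvd: "F dvd monom 1 m - 1" .
  have cardR: "card R = degree F"
    unfolding R_def
    by (rule card_roots_eq_degree[OF F_dvd m roots_of_unity_eq_powers(2)[OF prim]])
  have lc: "lead_coeff F = 1"
    using assms(2) by (simp add: F_def coeff_map_poly degree_map_poly)
  then have "F \<noteq> 0"
    by auto
  then have "finite R"
    unfolding R_def by (rule poly_roots_finite)
  have "poly (monom 1 m - 1) x = 0" if "poly F x = 0" for x
    using F_dvd that by (metis dvdE poly_mult mult_zero_left)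
  then have "R \<subseteq> {x. x ^ m = 1}"
    by (auto simp: R_def poly_monom)
  then have RT': "R = (\<lambda>i. \<zeta> m ^ i) ` T'"
    unfolding roots_of_unity_eq_powers(1)[OF prim] R_def T'_def by auto
  have inj: "inj_on (\<lambda>i. \<zeta> m ^ i) T'"
    by (rule inj_on_subset[OF primitive_root_inj_on[OF prim]]) (auto simp: T'_def)
  have "F = (\<Prod>x\<in>R. [:- x, 1:])"
    by (rule monic_eq_prod_roots[OF lc \<open>finite R\<close> cardR]) (simp add: R_def)
  then have F_T': "F = (\<Prod>\<gamma>\<in>T'. [:- (\<zeta> m ^ \<gamma>), 1:])"
    unfolding RT' using inj by (simp add: prod.reindex)
  have "T = T'"
    unfolding T_def primitive_defining_set_def m_def[symmetric] F_def[symmetric]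
  proof (rule the_equality)
    show "T' \<subseteq> {..<m} \<and>
        (\<exists>a. a \<noteq> 0 \<and> F = smult (to_ac a) (\<Prod>\<gamma>\<in>T'. [:- (\<zeta> m ^ \<gamma>), 1:]))"
      using F_T' by (auto simp: T'_def intro!: exI[of _ 1])
  next
    fix U assume "U \<subseteq> {..<m} \<and>
        (\<exists>a. a \<noteq> 0 \<and> F = smult (to_ac a) (\<Prod>\<gamma>\<in>U. [:- (\<zeta> m ^ \<gamma>), 1:]))"
    then obtain a where U: "U \<subseteq> {..<m}" "a \<noteq> 0"
      "F = smult (to_ac a) (\<Prod>\<gamma>\<in>U. [:- (\<zeta> m ^ \<gamma>), 1:])"
      by auto
    have "finite U"
      using U(1) finite_subset by blast
    \<comment> \<open>A nonzero scalar does not change the zeros, so any candidate \<open>U\<close>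
      can be read off from the roots of \<open>F\<close>.\<close>
    then have "poly F (\<zeta> m ^ i) = 0 \<longleftrightarrow> (\<exists>\<gamma>\<in>U. \<zeta> m ^ i = \<zeta> m ^ \<gamma>)" for i
      unfolding U(3) using U(2) by (auto simp: poly_prod)
    also have "\<dots> i \<longleftrightarrow> i \<in> U" if "i < m" for i
      using that U(1) primitive_root_inj_on[OF prim] by (auto dest: inj_onD)
    finally show "U = T'"
      using U(1) by (auto simp: T'_def)
  qed
  then show "T = {i. i < m \<and> poly F (\<zeta> m ^ i) = 0}"
    by (simp only: T'_def)
  show "F = (\<Prod>\<gamma>\<in>T. [:- (\<zeta> m ^ \<gamma>), 1:])"
    unfolding \<open>T = T'\<close> by (rule F_T')
  show "{x. poly F x = 0} = (\<lambda>i. \<zeta> m ^ i) ` T"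
    unfolding \<open>T = T'\<close> using RT' by (simp only: R_def)
  show "card T = degree F"
    unfolding \<open>T = T'\<close> cardR[symmetric] RT' by (rule card_image[OF inj, symmetric])
qed

subsection \<open>Cosets of roots of unity\<close>

text \<open>Divide with remainder, m = n k + r. Every x with x^n = b satisfies 1 = b^k x^r, so all n
  of them solve x^r = b^(-k). For 0 < r < n this equation has too few solutions.\<close>

lemma card_nth_roots_imp_dvd:
  fixes b :: "'a :: field"
  assumes "n > 0" "b \<noteq> 0" "card {x :: 'a. x ^ n = b} = n" "{x. x ^ n = b} \<subseteq> {x. x ^ m = 1}"
  shows "n dvd m"
proof (rule ccontr)
  assume "\<not> n dvd m"
  then have r: "m mod n > 0"
    by (simp add: dvd_eq_mod_eq_0)
  have "x ^ (m mod n) = inverse (b ^ (m div n))" if "x ^ n = b" for x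
  proof -
    have "1 = x ^ (n * (m div n) + m mod n)"
      using that assms(4) by auto
    also have "\<dots> = b ^ (m div n) * x ^ (m mod n)"
      by (simp only: power_add power_mult that)
    finally show ?thesis
      using inverse_unique by metis
  qed
  then have "card {x :: 'a. x ^ n = b} \<le> card {x. x ^ (m mod n) = inverse (b ^ (m div n))}"
    by (intro card_mono card_roots_of_unity_le r) auto
  also have "\<dots> \<le> m mod n"
    by (rule card_roots_of_unity_le[OF r])
  finally show False
    using assms(1,3) by (metis mod_less_divisor not_less)
qed

text \<open>Since m = n d, the power z^d is a primitive n-th root of unity. The exponents in
  \<open>S\<close> thus describe the coset of z^\<gamma> modulo the n-th roots of unity, and raising
  to the n-th power is constant on it. Both directions of the equivalence rest on this.\<close>

lemma equal_difference_roots: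
  fixes \<gamma> :: nat
  assumes "primitive_root_of_unity m z" "n > 0" "m = n * d"
  defines "S \<equiv> (\<lambda>i. (\<gamma> + i * d) mod m) ` {..<n}"
  shows "card S = n" "\<And>s. s \<in> S \<Longrightarrow> (z ^ s) ^ n = z ^ (\<gamma> * n)"
proof -
  have m: "m > 0" and z: "z \<noteq> 0"
    using assms(1) by (auto simp: primitive_root_of_unity_def power_0_left split: if_splits)
  then have d: "d > 0"
    using assms(3) by auto
  have "inj_on (\<lambda>i. (\<gamma> + i * d) mod m) {..<n}"
  proof (rule inj_onI)
    fix i j assume ij: "i \<in> {..<n}" "j \<in> {..<n}" "(\<gamma> + i * d) mod m = (\<gamma> + j * d) mod m"
    then have "z ^ (\<gamma> + i * d) = z ^ (\<gamma> + j * d)"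
      using primitive_root_power_mod[OF assms(1)] by metis
    then have "z ^ (i * d) = z ^ (j * d)"
      using z by (simp add: power_add)
    \<comment> \<open>Both exponents lie below n d = m, where powers of z are distinct.\<close>
    then have "i * d = j * d"
      using ij d assms(3) by (intro inj_onD[OF primitive_root_inj_on[OF assms(1)]]) auto
    then show "i = j"
      using d by simp
  qed
  then show "card S = n"
    by (simp add: S_def card_image)
  fix s assume "s \<in> S"
  then obtain i where "s = (\<gamma> + i * d) mod m"
    by (auto simp: S_def)
  then have "(z ^ s) ^ n = (z ^ (\<gamma> + i * d)) ^ n"
    by (simp add: primitive_root_power_mod[OF assms(1)])
  also have "\<dots> = z ^ (\<gamma> * n + m * i)"
    by (simp add: assms(3) algebra_simps flip: power_mult)
  also have "\<dots> = z ^ (\<gamma> * n)"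
    using assms(1) by (simp add: power_add power_mult primitive_root_of_unity_def del: mult.commute)
  finally show "(z ^ s) ^ n = z ^ (\<gamma> * n)" .
qed

theorem theorem3:
  fixes f :: "'a :: finite_field poly"
    and \<zeta> :: "nat \<Rightarrow> 'a alg_closure"
    and m :: nat
  assumes "compatible_roots_of_unity \<zeta>"
    and "degree f > 0"
    and "lead_coeff f = 1"
    and "squarefree f"
    and "coprime f [:0, 1:]"
    and "m = poly_ord f"
  shows "binomial_poly f \<longleftrightarrow> equal_difference_subset m (primitive_defining_set \<zeta> f)"
proof -
  define F T z where "F = map_poly to_ac f" and "T = primitive_defining_set \<zeta> f" and "z = \<zeta> m"
  have f0: "coeff f 0 \<noteq> 0"
    by (rule coprime_X_imp_coeff_0_nonzero) fact
  note T = primitive_defining_set_eq[OF assms(1,3,4) f0, folded assms(6), folded F_def T_def z_def]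
  have m: "m > 0"
    using T(5) by (simp add: primitive_root_of_unity_def)
  have "equal_difference_subset m T" if bin: "binomial_poly f"
  proof -
    obtain n c where "n \<ge> 1" and c: "c \<noteq> 0" and f: "f = monom 1 n - [:c:]"
      using bin unfolding binomial_poly_def by blast
    then have n: "n > 0"
      by simp
    have F: "F = monom 1 n - [:to_ac c:]"
      unfolding F_def f by (rule poly_eqI) (auto simp: coeff_map_poly coeff_pCons split: nat.split)
    have deg: "degree F = n"
      unfolding F by (rule degree_monom_minus_const(1)[OF n])
    have roots: "{x. poly F x = 0} = {x. x ^ n = to_ac c}"
      by (simp add: F poly_monom)
    have sub: "(\<lambda>i. z ^ i) ` T \<subseteq> {x. x ^ m = 1}"
      unfolding roots_of_unity_eq_powers(1)[OF T(5)] using T(1) by auto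
    have "inj_on (\<lambda>i. z ^ i) T"
      by (rule inj_on_subset[OF primitive_root_inj_on[OF T(5)]]) (use T(1) in auto)
    \<comment> \<open>The exponents in \<open>T\<close> correspond bijectively to the roots, so X^n
      - c has n distinct roots, all of them m-th roots of unity; this forces n | m.\<close>
    then have "card {x. x ^ n = to_ac c} = n"
      using T(3,4) by (simp add: roots deg card_image)
    moreover have "{x. x ^ n = to_ac c} \<subseteq> {x. x ^ m = 1}"
      using sub T(3) roots by simp
    ultimately have "n dvd m"
      using n c by (intro card_nth_roots_imp_dvd[of n "to_ac c"]) auto
    then obtain d where d: "m = n * d"
      by (elim dvdE)
    have "T \<noteq> {}"
      using T(4) deg n by auto
    then obtain \<gamma> where \<gamma>: "\<gamma> \<in> T"
      by auto
    \<comment> \<open>Any element of \<open>T\<close> can serve as the starting point, since a coset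
      is determined by each of its members. The progression consists of exponents of roots and has
      as many elements as \<open>T\<close>, hence equals \<open>T\<close>.\<close>
    define S where "S = (\<lambda>i. (\<gamma> + i * d) mod m) ` {..<n}"
    note S = equal_difference_roots[OF T(5) n d, where \<gamma> = \<gamma>, folded S_def]
    have "z ^ (\<gamma> * n) = to_ac c"
      using \<gamma> T(1) roots by (auto simp: power_mult)
    then have "poly F (z ^ s) = 0" if "s \<in> S" for s
      using S(2)[OF that] roots by auto
    then have "S \<subseteq> T"
      using m by (subst T(1)) (auto simp: S_def)
    moreover have "finite T"
      using T(4) deg n card_ge_0_finite by metis
    ultimately have "S = T"
      using S(1) T(4) deg by (intro card_subset_eq) auto
    moreover have "m div d = n" "d > 0" "\<gamma> < m"
      using d m \<gamma> T(1) by auto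
    ultimately show ?thesis
      unfolding equal_difference_subset_def S_def using d by (intro exI[of _ \<gamma>] exI[of _ d]) auto
  qed
  moreover have "binomial_poly f" if eq: "equal_difference_subset m T"
  proof -
    obtain \<gamma> d where \<gamma>: "\<gamma> < m" "d > 0" "d dvd m"
      and T_eq: "T = (\<lambda>i. (\<gamma> + i * d) mod m) ` {..<m div d}"
      using eq by (auto simp: equal_difference_subset_def)
    define n where "n = m div d"
    have d: "m = n * d" and n: "n > 0"
      using \<gamma> m by (auto simp: n_def dvd_imp_le div_greater_zero_iff)
    note S = equal_difference_roots[OF T(5) n d, where \<gamma> = \<gamma>, folded T_eq[folded n_def]]
    define b where "b = z ^ (\<gamma> * n)"
    have inj: "inj_on (\<lambda>i. z ^ i) T"
      by (rule inj_on_subset[OF primitive_root_inj_on[OF T(5)]]) (use T(1) in auto)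
    \<comment> \<open>The n powers z^\<gamma> with exponent in \<open>T\<close> share the n-th power
      b, so they are all the roots of X^n - b; they are also the roots of \<open>F\<close>.\<close>
    have "monom 1 n - [:b:] = (\<Prod>x\<in>(\<lambda>i. z ^ i) ` T. [:- x, 1:])"
    proof (rule monic_eq_prod_roots)
      show "finite ((\<lambda>i. z ^ i) ` T)"
        by (simp add: T_eq)
      show "card ((\<lambda>i. z ^ i) ` T) = degree (monom 1 n - [:b:])"
        by (simp add: card_image inj S(1) degree_monom_minus_const(1)[OF n])
      show "poly (monom 1 n - [:b:]) x = 0" if "x \<in> (\<lambda>i. z ^ i) ` T" for x
        using that S(2) by (auto simp: poly_monom b_def)
    qed (rule degree_monom_minus_const(2)[OF n])
    also have "\<dots> = F"
      by (subst T(2)) (simp add: prod.reindex inj)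
    finally have F: "monom 1 n - [:b:] = F" .
    have coeff: "to_ac (coeff f i) = coeff (monom 1 n - [:b:]) i" for i
      by (simp add: F) (simp add: F_def coeff_map_poly)
    \<comment> \<open>So far b lies only in the algebraic closure. As n > 0, comparing constant
      coefficients shows that -b is the image of \<open>coeff f 0\<close>, so the identity descends
      to the base field. The constant is nonzero because f is coprime to X.\<close>
    have "f = monom 1 n - [:- coeff f 0:]"
    proof (rule poly_eqI)
      fix i
      have "to_ac (coeff f i) = to_ac (coeff (monom 1 n - [:- coeff f 0:]) i)"
        unfolding coeff by (cases i) (use coeff[of 0] n in auto)
      then show "coeff f i = coeff (monom 1 n - [:- coeff f 0:]) i"
        by (simp only: to_ac_eq_iff)
    qed
    then show ?thesis
      unfolding binomial_poly_def using n f0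
      by (intro exI[of _ n] exI[of _ "- coeff f 0"]) auto
  qed
  ultimately show ?thesis
    unfolding T_def by blast
qed

end
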